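(* Let $(N,V)$ be the set-valued cooperative game associated with a multiobjective fractional linear production problem, as defined in the context. Then $(N,V)$ is balanced: for every balanced collection $\mathcal{B}$ of coalitions with balancing weights $\gamma(S)>0$, $S\in\mathcal{B}$, $$\sum_{S\in\mathcal{B}}\gamma(S)V(S)\subseteq V(N).$$
   Context: Let $N=\{1,\dots,n\}$ be the set of players; coalitions are nonempty subsets of $N$. There are $m$ resources, $p$ goods and $r$ objectives. Player $i$ owns a resource vector $b^i\in\mathbb{R}^m$ with nonnegative components, and $b(S)=\sum_{i\in S}b^i$ for a coalition $S$. Let $A\in\mathbb{R}^{m\times p}$, and $c_i,d_i\in\mathbb{R}^p$, $c_{i0},d_{i0}\in\mathbb{R}$ for $i=1,\dots,r$. Put $N_i(x)=c_i\cdot x+c_{i0}$, $D_i(x)=d_i\cdot x+d_{i0}$. Coalition $S$ faces the problem of maximizing the vector $\left(\frac{N_1(x)}{D_1(x)},\dots,\frac{N_r(x)}{D_r(x)}\right)$ over $D_S=\{x\in\mathbb{R}^p:Ax\le b(S),\ x\ge 0\}$. Standing assumptions, for every coalition $S$: $D_S$ is nonempty and bounded; $D_i(x)>0$ for all $x\in D_S$ and all $i$; and for every $i$ there is $x\in D_S$ with $N_i(x)\ge 0$. The problem is transformed to a multiobjective linear problem with feasible set $$T_S=\{(t,y)\in\mathbb{R}\times\mathbb{R}^p:\ d_i\cdot y+d_{i0}t\le 1\ (i=1,\dots,r),\ Ay-t\,b(S)\le 0,\ t\ge 0,\ y\ge 0\}$$ and image in objective space $$\widehat T_S=\{(c_1\cdot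 y+c_{10}t,\dots,c_r\cdot y+c_{r0}t):(t,y)\in T_S\}\subseteq\mathbb{R}^r.$$ For $Z\subseteq\mathbb{R}^r$, $\mathrm{Max}\,Z$ denotes the set of Pareto maximal elements of $Z$, i.e. those $z\in Z$ for which there is no $z'\in Z$ with $z'\ge z$ componentwise and $z'\ne z$. A collection $\mathcal{B}$ of coalitions is balanced if there are weights $\gamma(S)>0$, $S\in\mathcal{B}$ (balancing weights), such that $\sum_{S\in\mathcal{B},\,i\in S}\gamma(S)=1$ for each $i\in N$. Let $\gamma^*$ be the maximum of $\sum_{S\in\mathcal{B}}\gamma(S)$ over all balanced collections (and their balancing weights), and fix $\gamma>\max(\gamma^*,n)$. The game assigns to each coalition a subset of $\mathbb{R}^r$: $V(S)=(\mathrm{Max}\,\widehat T_S-\mathbb{R}^r_+)\cap\mathbb{R}^r_+$ for nonempty $S\subsetneq N$, and $V(N)=(\mathrm{Max}(\gamma\widehat T_N)-\mathbb{R}^r_+)\cap\mathbb{R}^r_+$. Sums and scalar multiples of sets are in the Minkowski sense. *)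

theory Defs
  imports "HOL-Analysis.Analysis"
begin

text \<open>
  Players, resources, goods and objectives are indexed by the finite types \<open>'n\<close>, \<open>'m\<close>, \<open>'p\<close>
  and \<open>'r\<close>; the grand coalition is \<open>UNIV :: 'n set\<close> and coalitions are the nonempty sets of
  type \<open>'n set\<close>. The order on \<open>real ^ 'k\<close> is componentwise, and sums of sets are Minkowski
  sums (theory \<open>HOL-Library.Set_Algebras\<close>).
\<close>

definition affine_form :: "('r \<Rightarrow> real ^ 'p) \<Rightarrow> ('r \<Rightarrow> real) \<Rightarrow> 'r \<Rightarrow> real ^ 'p \<Rightarrow> real" where
  "affine_form c c0 i x = c i \<bullet> x + c0 i"

definition coalition_resources :: "('n::finite \<Rightarrow> real ^ 'm) \<Rightarrow> 'n set \<Rightarrow> real ^ 'm" where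
  "coalition_resources b S = (\<Sum>i\<in>S. b i)"

definition feasible :: "real ^ 'p ^ 'm \<Rightarrow> ('n::finite \<Rightarrow> real ^ 'm) \<Rightarrow> 'n set \<Rightarrow> (real ^ 'p) set" where
  "feasible A b S = {x. A *v x \<le> coalition_resources b S \<and> 0 \<le> x}"

definition feasible_lin ::
  "real ^ 'p ^ 'm \<Rightarrow> ('n::finite \<Rightarrow> real ^ 'm) \<Rightarrow> ('r \<Rightarrow> real ^ 'p) \<Rightarrow> ('r \<Rightarrow> real) \<Rightarrow>
    'n set \<Rightarrow> (real \<times> (real ^ 'p)) set" where
  "feasible_lin A b d d0 S =
     {(t, y). (\<forall>i. d i \<bullet> y + d0 i * t \<le> 1) \<and>
       A *v y - t *\<^sub>R coalition_resources b S \<le> 0 \<and> 0 \<le> t \<and> 0 \<le> y}"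

definition image_lin ::
  "real ^ 'p ^ 'm \<Rightarrow> ('n::finite \<Rightarrow> real ^ 'm) \<Rightarrow> ('r \<Rightarrow> real ^ 'p) \<Rightarrow> ('r \<Rightarrow> real) \<Rightarrow>
    ('r \<Rightarrow> real ^ 'p) \<Rightarrow> ('r \<Rightarrow> real) \<Rightarrow> 'n set \<Rightarrow> (real ^ 'r) set" where
  "image_lin A b c c0 d d0 S = {\<chi> i. c i \<bullet> y + c0 i * t |t y. (t, y) \<in> feasible_lin A b d d0 S}"

definition pareto_max :: "(real ^ 'r) set \<Rightarrow> (real ^ 'r) set" where
  "pareto_max Z = {z \<in> Z. \<not> (\<exists>z'\<in>Z. z \<le> z' \<and> z' \<noteq> z)}"

definition scale_set :: "real \<Rightarrow> (real ^ 'r) set \<Rightarrow> (real ^ 'r) set" where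
  "scale_set a Z = (\<lambda>z. a *\<^sub>R z) ` Z"

definition comprehensive_hull_pos :: "(real ^ 'r) set \<Rightarrow> (real ^ 'r) set" where
  "comprehensive_hull_pos Z = {z - u |z u. z \<in> Z \<and> 0 \<le> u} \<inter> {v. 0 \<le> v}"

text \<open>Only the values at nonempty \<open>S\<close> are meaningful.\<close>

definition game ::
  "real \<Rightarrow> real ^ 'p ^ 'm \<Rightarrow> ('n::finite \<Rightarrow> real ^ 'm) \<Rightarrow> ('r \<Rightarrow> real ^ 'p) \<Rightarrow> ('r \<Rightarrow> real) \<Rightarrow>
    ('r \<Rightarrow> real ^ 'p) \<Rightarrow> ('r \<Rightarrow> real) \<Rightarrow> 'n set \<Rightarrow> (real ^ 'r) set" where
  "game \<gamma> A b c c0 d d0 S =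
     (if S = UNIV
      then comprehensive_hull_pos (pareto_max (scale_set \<gamma> (image_lin A b c c0 d d0 S)))
      else comprehensive_hull_pos (pareto_max (image_lin A b c c0 d d0 S)))"

definition balancing_weights :: "'n::finite set set \<Rightarrow> ('n set \<Rightarrow> real) \<Rightarrow> bool" where
  "balancing_weights B w \<longleftrightarrow>
     {} \<notin> B \<and> (\<forall>S\<in>B. 0 < w S) \<and> (\<forall>i. (\<Sum>S | S \<in> B \<and> i \<in> S. w S) = 1)"

definition total_weights :: "'n::finite itself \<Rightarrow> real set" where
  "total_weights _ = {\<Sum>S\<in>B. w S |(B :: 'n set set) w. balancing_weights B w}"

definition max_total_weight :: "'n::finite itself \<Rightarrow> real" where
  "max_total_weight T = (GREATEST x. x \<in> total_weights T)"

text \<open>The maximum exists, so \<open>GREATEST\<close> denotes it.\<close>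

lemma max_total_weight_is_maximum:
  "max_total_weight TYPE('n::finite) \<in> total_weights TYPE('n)"
  "x \<in> total_weights TYPE('n) \<Longrightarrow> x \<le> max_total_weight TYPE('n)"
proof -
  let ?P = "\<lambda>x. x \<in> total_weights TYPE('n)"
  let ?B = "range (\<lambda>i::'n. {i})"
  have "(\<Sum>S | S \<in> ?B \<and> i \<in> S. 1::real) = 1" for i :: 'n
  proof -
    have "{S. S \<in> ?B \<and> i \<in> S} = {{i}}" by auto
    then show ?thesis by simp
  qed
  then have "balancing_weights ?B (\<lambda>_. 1)"
    by (auto simp: balancing_weights_def)
  moreover have "(\<Sum>S\<in>?B. 1::real) = real CARD('n)"
    by (simp add: card_image)
  ultimately have att: "?P (real CARD('n))"
    unfolding total_weights_def by (auto intro!: exI[of _ ?B] exI[of _ "\<lambda>_. 1::real"])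
  have bound: "y \<le> real CARD('n)" if yP: "?P y" for y
  proof -
    obtain B :: "'n set set" and w where y: "y = (\<Sum>S\<in>B. w S)" and bw: "balancing_weights B w"
      using yP by (auto simp: total_weights_def)
    have "w S \<le> (\<Sum>i\<in>S. w S)" if "S \<in> B" for S
    proof -
      have "0 < w S" "S \<noteq> {}" using bw that by (auto simp: balancing_weights_def)
      then have "1 \<le> card S" by (simp add: Suc_le_eq card_gt_0_iff)
      then show ?thesis using \<open>0 < w S\<close> by simp
    qed
    then have "y \<le> (\<Sum>S\<in>B. \<Sum>i\<in>S. w S)" unfolding y by (rule sum_mono)
    also have "\<dots> = (\<Sum>S\<in>B. \<Sum>i | i \<in> UNIV \<and> i \<in> S. w S)" by simp
    also have "\<dots> = (\<Sum>i\<in>UNIV. \<Sum>S | S \<in> B \<and> i \<in> S. w S)" by (rule sum.swap_restrict) simp_all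
    also have "\<dots> = real CARD('n)" using bw by (simp add: balancing_weights_def)
    finally show ?thesis .
  qed
  show "?P (max_total_weight TYPE('n))"
    unfolding max_total_weight_def using att bound by (rule GreatestI2_order) simp
  show "x \<le> max_total_weight TYPE('n)" if "x \<in> total_weights TYPE('n)"
    unfolding max_total_weight_def using Greatest_equality[of ?P, OF att bound] bound[OF that] by simp
qed

end

theory Submission
  imports Defs
begin

text \<open>
  Since \<open>b \<ge> 0\<close>, every \<open>T\<^sub>S\<close> is contained in \<open>T\<^sub>N\<close>, which is convex, contains the origin and is
  compact. Balancing weights satisfy \<open>\<Sum>\<^sub>S w(S) |S| = n\<close>, so if the value of the grand coalition is
  counted with the extra factor \<open>\<gamma> \<ge> n\<close>, the total weight is still at most \<open>\<gamma>\<close>. Hence a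
  balanced combination of payoffs is dominated by a point of the image of \<open>\<gamma> T\<^sub>N\<close>, and by compactness
  by a Pareto maximal one.
\<close>

section \<open>Pareto maximal points and comprehensive hulls of compact sets\<close>

text \<open>Maximize the coordinate sum over the points of \<open>Z\<close> above \<open>z\<close>.
  A point of \<open>Z\<close> dominating the maximizer and distinct from it would still lie above
  \<open>z\<close> and have a strictly larger sum.\<close>

lemma compact_pareto_max_dominates:
  fixes Z :: "(real ^ 'r::finite) set"
  assumes "compact Z" "z \<in> Z"
  obtains z' where "z' \<in> pareto_max Z" "z \<le> z'"
proof -
  have "closed {x :: real ^ 'r. z \<le> x}"
    unfolding less_eq_vec_def
    by (intro closed_Collect_all closed_Collect_le continuous_intros)
  then have "compact (Z \<inter> {x. z \<le> x})"
    using assms(1) by (rule compact_Int_closed[rotated])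
  moreover have "Z \<inter> {x. z \<le> x} \<noteq> {}"
    using assms(2) by auto
  moreover have "continuous_on (Z \<inter> {x. z \<le> x}) (\<lambda>x. \<Sum>i\<in>UNIV. x $ i)"
    by (intro continuous_intros)
  ultimately obtain m where m: "m \<in> Z" "z \<le> m"
    and max: "\<And>x. x \<in> Z \<Longrightarrow> z \<le> x \<Longrightarrow> (\<Sum>i\<in>UNIV. x $ i) \<le> (\<Sum>i\<in>UNIV. m $ i)"
    using continuous_attains_sup[of "Z \<inter> {x. z \<le> x}" "\<lambda>x. \<Sum>i\<in>UNIV. x $ i"] by auto
  have "z' = m" if z': "z' \<in> Z" "m \<le> z'" for z'
  proof (rule ccontr)
    assume "z' \<noteq> m"
    then obtain i where "z' $ i \<noteq> m $ i"
      by (auto simp: vec_eq_iff)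
    with z'(2) have "m $ i < z' $ i"
      by (auto simp: less_eq_vec_def order_less_le)
    with z'(2) have "(\<Sum>i\<in>UNIV. m $ i) < (\<Sum>i\<in>UNIV. z' $ i)"
      by (intro sum_strict_mono_ex1) (auto simp: less_eq_vec_def)
    moreover have "z \<le> z'"
      using m(2) z'(2) by (rule order_trans)
    ultimately show False
      using max[OF z'(1)] by simp
  qed
  then have "m \<in> pareto_max Z"
    using m(1) by (auto simp: pareto_max_def)
  then show thesis
    using m(2) that by blast
qed

text \<open>Compactness removes Pareto maximality from the description of the game: any dominating
  point of \<open>Z\<close> can be raised to a maximal one, so payoffs are handled through plain
  domination from here on.\<close>

lemma comprehensive_hull_pos_pareto_max_iff:
  fixes Z :: "(real ^ 'r::finite) set"
  assumes "compact Z"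
  shows "v \<in> comprehensive_hull_pos (pareto_max Z) \<longleftrightarrow> 0 \<le> v \<and> (\<exists>z\<in>Z. v \<le> z)"
proof
  assume "v \<in> comprehensive_hull_pos (pareto_max Z)"
  then show "0 \<le> v \<and> (\<exists>z\<in>Z. v \<le> z)"
    by (force simp: comprehensive_hull_pos_def pareto_max_def less_eq_vec_def)
next
  assume *: "0 \<le> v \<and> (\<exists>z\<in>Z. v \<le> z)"
  then obtain z where z: "z \<in> Z" "v \<le> z"
    by blast
  obtain z' where z': "z' \<in> pareto_max Z" "z \<le> z'"
    using compact_pareto_max_dominates[OF assms z(1)] .
  have "v = z' - (z' - v)" "0 \<le> z' - v"
    using z(2) z'(2) by (auto simp: less_eq_vec_def intro: order_trans)
  then show "v \<in> comprehensive_hull_pos (pareto_max Z)"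
    unfolding comprehensive_hull_pos_def using z'(1) * by blast
qed

text \<open>After division by \<open>\<gamma>\<close> the weights sum to at most 1; the origin,
  being in \<open>Z\<close>, absorbs the missing weight.\<close>

lemma convex_sum_mem_scale_set:
  fixes Z :: "(real ^ 'r) set"
  assumes "convex Z" "0 \<in> Z" "finite I"
    and a: "\<And>i. i \<in> I \<Longrightarrow> 0 \<le> a i" "sum a I \<le> \<gamma>" "0 < \<gamma>"
    and u: "\<And>i. i \<in> I \<Longrightarrow> u i \<in> Z"
  shows "(\<Sum>i\<in>I. a i *\<^sub>R u i) \<in> scale_set \<gamma> Z"
proof -
  \<comment> \<open>The index \<open>None\<close> carries the slack weight and the origin, which
    turns the sum into a genuine convex combination.\<close>
  have "(\<Sum>j\<in>insert None (Some ` I).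
          (case j of None \<Rightarrow> 1 - sum a I / \<gamma> | Some i \<Rightarrow> a i / \<gamma>) *\<^sub>R
          (case j of None \<Rightarrow> 0 | Some i \<Rightarrow> u i)) \<in> Z"
    using assms
    by (intro convex_sum)
       (auto simp: sum.reindex sum_divide_distrib[symmetric] split: option.split)
  then have "(\<Sum>i\<in>I. (a i / \<gamma>) *\<^sub>R u i) \<in> Z"
    using assms(3) by (simp add: sum.reindex)
  moreover have "(\<Sum>i\<in>I. a i *\<^sub>R u i) = \<gamma> *\<^sub>R (\<Sum>i\<in>I. (a i / \<gamma>) *\<^sub>R u i)"
    using a(3) by (simp add: scaleR_sum_right)
  ultimately show ?thesis
    unfolding scale_set_def by blast
qed

section \<open>The transformed feasible set as a polyhedron\<close>

text \<open>Nonnegative endowments make the resources grow with the coalition, and \<open>t\<close>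
  is nonnegative, so enlarging the coalition only relaxes the resource constraint.\<close>

lemma feasible_lin_mono:
  assumes "\<And>i. 0 \<le> b i" "S \<subseteq> S'"
  shows "feasible_lin A b d d0 S \<subseteq> feasible_lin A b d d0 S'"
proof -
  have "(\<Sum>i\<in>S. b i $ j) \<le> (\<Sum>i\<in>S'. b i $ j)" for j
    using assms by (intro sum_mono2) (auto simp: less_eq_vec_def)
  then have "t * (\<Sum>i\<in>S. b i $ j) \<le> t * (\<Sum>i\<in>S'. b i $ j)" if "0 \<le> t" for t j
    using that by (rule mult_left_mono)
  then show ?thesis
    by (fastforce simp: feasible_lin_def less_eq_vec_def coalition_resources_def intro: order_trans)
qed

lemma zero_mem_feasible_lin: "(0, 0) \<in> feasible_lin A b d d0 S"
  by (simp add: feasible_lin_def)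

text \<open>An intersection of closed half-spaces, from which convexity and closedness follow piece
  by piece.\<close>

lemma feasible_lin_eq_Inter:
  "feasible_lin A b d d0 S =
     (\<Inter>i. {z. d i \<bullet> snd z + d0 i * fst z \<le> 1}) \<inter>
     (\<Inter>j. {z. (A *v snd z) $ j - fst z * coalition_resources b S $ j \<le> 0}) \<inter>
     {z. 0 \<le> fst z} \<inter> (\<Inter>k. {z. 0 \<le> snd z $ k})"
  by (auto simp: feasible_lin_def less_eq_vec_def)

lemma convex_linear_le:
  fixes f :: "'a::real_vector \<Rightarrow> real"
  assumes "linear f"
  shows "convex {z. f z \<le> k}"
  using convex_linear_vimage[OF assms convex_real_interval(2)[of k]]
  by (simp add: vimage_def)

lemma convex_feasible_lin: "convex (feasible_lin A b d d0 S)"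
proof -
  have "linear (\<lambda>z. d i \<bullet> snd z + d0 i * fst z)" for i
    by (rule linearI) (simp_all add: algebra_simps)
  moreover have "linear (\<lambda>z. (A *v snd z) $ j - fst z * coalition_resources b S $ j)" for j
    by (rule linearI) (simp_all add: algebra_simps matrix_vector_mult_scaleR)
  \<comment> \<open>The sign constraints are negated to fit the form \<open>f z \<le> 0\<close> of
    \<open>convex_linear_le\<close>.\<close>
  moreover have "linear (\<lambda>z :: real \<times> (real ^ 'a). - fst z)"
    by (rule linearI) simp_all
  moreover have "linear (\<lambda>z :: real \<times> (real ^ 'a). - (snd z $ k))" for k
    by (rule linearI) simp_all
  ultimately show ?thesis
    unfolding feasible_lin_eq_Inter
    using convex_linear_le[of "\<lambda>z :: real \<times> (real ^ 'a). - fst z" 0]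
      convex_linear_le[of "\<lambda>z :: real \<times> (real ^ 'a). - (snd z $ _)" 0]
    by (intro convex_Int convex_INT convex_linear_le) auto
qed

lemma continuous_on_matrix_vector_mult:
  fixes A :: "real ^ 'p ^ 'm"
  assumes "continuous_on X f"
  shows "continuous_on X (\<lambda>x. A *v f x)"
  using bounded_linear.continuous_on[OF matrix_vector_mul_bounded_linear assms] .

lemma closed_feasible_lin: "closed (feasible_lin A b d d0 S)"
  unfolding feasible_lin_eq_Inter
  by (intro closed_Int closed_INT ballI closed_Collect_le continuous_intros
        continuous_on_matrix_vector_mult)

lemma closed_feasible: "closed (feasible A b S)"
  unfolding feasible_def less_eq_vec_def
  by (intro closed_Collect_conj closed_Collect_all closed_Collect_le continuous_intros
        continuous_on_matrix_vector_mult)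

section \<open>Boundedness of the transformed feasible set\<close>

text \<open>Such a \<open>y\<close> is a recession direction: nonnegative multiples of it can be
  added to a feasible point without leaving the feasible set, which boundedness forbids unless
  \<open>y\<close> vanishes.\<close>

lemma feasible_recession_zero:
  assumes "feasible A b S \<noteq> {}" "bounded (feasible A b S)" "A *v y \<le> 0" "0 \<le> y"
  shows "y = 0"
proof (rule ccontr)
  assume "y \<noteq> 0"
  obtain x where x: "x \<in> feasible A b S"
    using assms(1) by blast
  obtain M where M: "\<And>z. z \<in> feasible A b S \<Longrightarrow> norm z \<le> M"
    using assms(2) by (auto simp: bounded_iff)
  \<comment> \<open>Chosen so that \<open>k *\<^sub>R y\<close> has norm
    \<open>M + norm x + 1\<close>, one more than the triangle inequality allows when both
    \<open>x + k *\<^sub>R y\<close> and \<open>x\<close> are feasible.\<close>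
  define k where "k = (M + norm x + 1) / norm y"
  have "0 \<le> M"
    using M[OF x] norm_ge_zero order_trans by blast
  then have "0 \<le> k"
    by (simp add: k_def)
  then have "k * (A *v y) $ j \<le> 0" "0 \<le> k * y $ l" for j l
    using assms(3,4) by (auto simp: less_eq_vec_def mult_nonneg_nonpos)
  then have "x + k *\<^sub>R y \<in> feasible A b S"
    using x
    by (auto simp: feasible_def less_eq_vec_def matrix_vector_right_distrib matrix_vector_mult_scaleR
        intro: add_increasing2 add_decreasing2)
  then have "norm (x + k *\<^sub>R y) \<le> M"
    by (rule M)
  moreover have "norm (k *\<^sub>R y) = M + norm x + 1"
    using \<open>y \<noteq> 0\<close> \<open>0 \<le> M\<close> by (simp add: k_def)
  moreover have "norm (k *\<^sub>R y) \<le> norm (x + k *\<^sub>R y) + norm x"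
    using norm_triangle_ineq4[of "x + k *\<^sub>R y" x] by simp
  ultimately show False
    by simp
qed

text \<open>Points with \<open>t > 0\<close> correspond to feasible \<open>x = y / t\<close> (the
  Charnes-Cooper substitution); a positive lower bound on a denominator then bounds
  \<open>t\<close>, and with it \<open>y\<close>. Points with \<open>t = 0\<close> have
  \<open>y\<close> in the recession cone, which is trivial.\<close>

lemma bounded_feasible_lin:
  fixes d :: "'r::finite \<Rightarrow> real ^ 'p"
  assumes ne: "feasible A b S \<noteq> {}"
    and bdd: "bounded (feasible A b S)"
    and pos: "\<And>i x. x \<in> feasible A b S \<Longrightarrow> 0 < affine_form d d0 i x"
  shows "bounded (feasible_lin A b d d0 S)"
proof -
  obtain M where M: "\<And>z. z \<in> feasible A b S \<Longrightarrow> norm z \<le> M"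
    using bdd by (auto simp: bounded_iff)
  then have "0 \<le> M"
    using ne norm_ge_zero order_trans by blast
  \<comment> \<open>A single denominator suffices to bound \<open>t\<close>, so an arbitrary
    objective is fixed; its minimum over the compact feasible set is attained, hence
    positive.\<close>
  fix i :: 'r
  have "compact (feasible A b S)"
    using closed_feasible bdd by (simp add: compact_eq_bounded_closed)
  moreover have "continuous_on (feasible A b S) (affine_form d d0 i)"
    unfolding affine_form_def by (intro continuous_intros)
  ultimately obtain x0 where x0: "x0 \<in> feasible A b S"
    and min: "\<And>x. x \<in> feasible A b S \<Longrightarrow> affine_form d d0 i x0 \<le> affine_form d d0 i x"
    using ne continuous_attains_inf by metis
  define \<delta> where "\<delta> = affine_form d d0 i x0"
  have "0 < \<delta>"
    using pos[OF x0] by (simp add: \<delta>_def)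
  have "norm (t, y) \<le> 1 / \<delta> + M / \<delta>" if ty: "(t, y) \<in> feasible_lin A b d d0 S" for t y
  proof (cases "t = 0")
    case True
    then have "y = 0"
      using ty by (intro feasible_recession_zero[OF ne bdd]) (auto simp: feasible_lin_def)
    then show ?thesis
      using True \<open>0 < \<delta>\<close> \<open>0 \<le> M\<close> by simp
  next
    case False
    then have "0 < t"
      using ty by (auto simp: feasible_lin_def)
    define x where "x = (1 / t) *\<^sub>R y"
    have y: "y = t *\<^sub>R x"
      using \<open>0 < t\<close> by (simp add: x_def)
    have x: "x \<in> feasible A b S"
      using ty \<open>0 < t\<close>
      by (auto simp: y feasible_def feasible_lin_def less_eq_vec_def matrix_vector_mult_scaleR
          zero_le_mult_iff)
    have "t * affine_form d d0 i x \<le> 1"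
      using ty by (auto simp: y feasible_lin_def affine_form_def algebra_simps)
    moreover have "t * \<delta> \<le> t * affine_form d d0 i x"
      using min[OF x] \<open>0 < t\<close> by (simp add: \<delta>_def)
    ultimately have t: "t \<le> 1 / \<delta>"
      using \<open>0 < \<delta>\<close> by (simp add: field_simps)
    have "norm (t, y) \<le> t + t * norm x"
      using norm_Pair_le[of t y] \<open>0 < t\<close> by (simp add: y)
    also have "\<dots> \<le> 1 / \<delta> + 1 / \<delta> * M"
      using t M[OF x] \<open>0 < t\<close> \<open>0 < \<delta>\<close> by (intro add_mono mult_mono) auto
    finally show ?thesis
      by simp
  qed
  then show ?thesis
    unfolding bounded_iff by fast
qed

section \<open>The image in objective space\<close>

lemma image_lin_eq_image:
  "image_lin A b c c0 d d0 S =
     (\<lambda>z. \<chi> i. c i \<bullet> snd z + c0 i * fst z) ` feasible_lin A b d d0 S"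
  by (force simp: image_lin_def)

lemma linear_objective: "linear (\<lambda>z. \<chi> i. c i \<bullet> snd z + c0 i * fst z)"
  by (rule linearI) (simp_all add: vec_eq_iff algebra_simps)

lemma image_lin_mono:
  assumes "\<And>i. 0 \<le> b i" "S \<subseteq> S'"
  shows "image_lin A b c c0 d d0 S \<subseteq> image_lin A b c c0 d d0 S'"
  unfolding image_lin_eq_image using feasible_lin_mono[OF assms] by (rule image_mono)

lemma convex_image_lin: "convex (image_lin A b c c0 d d0 S)"
  unfolding image_lin_eq_image
  by (rule convex_linear_image[OF linear_objective convex_feasible_lin])

lemma zero_mem_image_lin: "0 \<in> image_lin A b c c0 d d0 S"
  unfolding image_lin_eq_image
  by (rule image_eqI[OF _ zero_mem_feasible_lin]) (simp add: vec_eq_iff)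

lemma compact_image_lin:
  fixes d :: "'r::finite \<Rightarrow> real ^ 'p"
  assumes "feasible A b S \<noteq> {}" "bounded (feasible A b S)"
    and "\<And>i x. x \<in> feasible A b S \<Longrightarrow> 0 < affine_form d d0 i x"
  shows "compact (image_lin A b c c0 d d0 S)"
  unfolding image_lin_eq_image
  using bounded_feasible_lin[OF assms] closed_feasible_lin
  by (intro compact_continuous_image linear_continuous_on)
     (auto simp: compact_eq_bounded_closed linear_objective simp flip: linear_conv_bounded_linear)

section \<open>Estimates for balancing weights\<close>

text \<open>Double counting of the pairs of a coalition in \<open>B\<close> and one of its members:
  each player contributes total weight 1.\<close>

lemma balancing_weights_sum_card:
  fixes B :: "'n::finite set set"
  assumes "balancing_weights B w"
  shows "(\<Sum>S\<in>B. w S * real (card S)) = real CARD('n)"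
proof -
  have "(\<Sum>S\<in>B. w S * real (card S)) = (\<Sum>S\<in>B. \<Sum>i | i \<in> UNIV \<and> i \<in> S. w S)"
    by (simp add: mult.commute)
  also have "\<dots> = (\<Sum>i\<in>UNIV. \<Sum>S | S \<in> B \<and> i \<in> S. w S)"
    by (rule sum.swap_restrict) simp_all
  also have "\<dots> = real CARD('n)"
    using assms by (simp add: balancing_weights_def)
  finally show ?thesis .
qed

text \<open>Each factor is at most \<open>\<gamma> / n\<close> times \<open>card S\<close>, where
  \<open>n\<close> is the number of players: with equality for the grand coalition, and otherwise
  because \<open>card S \<ge> 1\<close> and \<open>\<gamma> \<ge> n\<close>. Double counting then
  sums these bounds to exactly \<open>\<gamma>\<close>.\<close>

lemma balancing_weights_sum_le:
  fixes B :: "'n::finite set set"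
  assumes bw: "balancing_weights B w" and \<gamma>: "real CARD('n) \<le> \<gamma>"
  shows "(\<Sum>S\<in>B. w S * (if S = UNIV then \<gamma> else 1)) \<le> \<gamma>"
proof -
  have "w S * (if S = UNIV then \<gamma> else 1) \<le> \<gamma> / real CARD('n) * (w S * real (card S))"
    if "S \<in> B" for S
  proof -
    have S: "0 < w S" "S \<noteq> {}"
      using bw that by (auto simp: balancing_weights_def)
    have "1 \<le> card S"
      using S(2) by (simp add: Suc_le_eq card_gt_0_iff)
    moreover have "1 \<le> \<gamma> / real CARD('n)"
      using \<gamma> by simp
    ultimately have "1 * 1 \<le> \<gamma> / real CARD('n) * real (card S)"
      by (intro mult_mono) auto
    then have "(if S = UNIV then \<gamma> else 1) \<le> \<gamma> / real CARD('n) * real (card S)"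
      by simp
    then have "w S * (if S = UNIV then \<gamma> else 1) \<le> w S * (\<gamma> / real CARD('n) * real (card S))"
      using S(1) by (intro mult_left_mono) auto
    then show ?thesis
      by (simp add: mult_ac)
  qed
  then have "(\<Sum>S\<in>B. w S * (if S = UNIV then \<gamma> else 1)) \<le>
      (\<Sum>S\<in>B. \<gamma> / real CARD('n) * (w S * real (card S)))"
    by (rule sum_mono)
  also have "\<dots> = \<gamma>"
    unfolding sum_distrib_left[symmetric] balancing_weights_sum_card[OF bw] by simp
  finally show ?thesis .
qed

section \<open>Balancedness of the game\<close>

theorem theorem4:
  fixes A :: "real ^ 'p ^ 'm"
    and b :: "'n::finite \<Rightarrow> real ^ 'm"
    and c d :: "'r::finite \<Rightarrow> real ^ 'p"
    and c0 d0 :: "'r \<Rightarrow> real"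
    and \<gamma> :: real
    and B :: "'n set set"
    and w :: "'n set \<Rightarrow> real"
  assumes "\<And>i. 0 \<le> b i"
    and "\<And>S. S \<noteq> {} \<Longrightarrow> feasible A b S \<noteq> {}"
    and "\<And>S. S \<noteq> {} \<Longrightarrow> bounded (feasible A b S)"
    and "\<And>S i x. S \<noteq> {} \<Longrightarrow> x \<in> feasible A b S \<Longrightarrow> 0 < affine_form d d0 i x"
    and "\<And>S i. S \<noteq> {} \<Longrightarrow> \<exists>x\<in>feasible A b S. 0 \<le> affine_form c c0 i x"
    and "\<gamma> > max (max_total_weight TYPE('n)) (real CARD('n))"
    and "balancing_weights B w"
  shows "(\<Sum>S\<in>B. scale_set (w S) (game \<gamma> A b c c0 d d0 S)) \<subseteq> game \<gamma> A b c c0 d d0 UNIV"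
proof
  let ?Z = "image_lin A b c c0 d d0"
  let ?k = "\<lambda>S :: 'n set. if S = UNIV then \<gamma> else 1"
  have "real CARD('n) \<le> \<gamma>"
    using assms(6) by simp
  moreover have "0 < real CARD('n)"
    by simp
  ultimately have "0 < \<gamma>"
    by linarith
  have cpt: "compact (?Z S)" if "S \<noteq> {}" for S
    using assms(2-4)[OF that] by (rule compact_image_lin)
  have cptN: "compact (scale_set \<gamma> (?Z UNIV))"
    unfolding scale_set_def using cpt by (intro compact_scaling) simp
  have wpos: "0 < w S" "S \<noteq> {}" if "S \<in> B" for S
    using assms(7) that by (auto simp: balancing_weights_def)
  fix v
  assume "v \<in> (\<Sum>S\<in>B. scale_set (w S) (game \<gamma> A b c c0 d d0 S))"
  then obtain s where v: "v = sum s B"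
    and s: "\<And>S. S \<in> B \<Longrightarrow> s S \<in> scale_set (w S) (game \<gamma> A b c c0 d d0 S)"
    by (auto simp: set_sum_alt)
  \<comment> \<open>All payoffs are compared with points of one convex set, the unscaled image of
    the grand coalition. The scaling by \<open>\<gamma>\<close> present in the game value at
    \<open>UNIV\<close> moves into the coefficient \<open>?k S\<close>; for proper coalitions
    monotonicity of the image supplies \<open>u\<close>.\<close>
  have "\<exists>u\<in>?Z UNIV. 0 \<le> s S \<and> s S \<le> (w S * ?k S) *\<^sub>R u" if S: "S \<in> B" for S
  proof -
    obtain g where g: "g \<in> game \<gamma> A b c c0 d d0 S" and sS: "s S = w S *\<^sub>R g"
      using s[OF S] by (auto simp: scale_set_def)
    have "0 \<le> g \<and> (\<exists>u\<in>?Z UNIV. g \<le> ?k S *\<^sub>R u)"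
    proof (cases "S = UNIV")
      case True
      then show ?thesis
        using g cptN
        by (auto simp: game_def comprehensive_hull_pos_pareto_max_iff) (auto simp: scale_set_def)
    next
      case False
      then show ?thesis
        using g cpt[OF wpos(2)[OF S]] image_lin_mono[where b = b and S = S and S' = UNIV, OF assms(1)]
        by (force simp: game_def comprehensive_hull_pos_pareto_max_iff)
    qed
    then obtain u where u: "u \<in> ?Z UNIV" "0 \<le> g" "g \<le> ?k S *\<^sub>R u"
      by blast
    have "0 \<le> s S"
      using u(2) wpos(1)[OF S] by (simp add: sS less_eq_vec_def)
    moreover have "w S *\<^sub>R g \<le> w S *\<^sub>R ?k S *\<^sub>R u"
      using u(3) wpos(1)[OF S] by (simp add: less_eq_vec_def)
    ultimately show ?thesis
      using u(1) by (intro bexI[of _ u]) (simp_all add: sS)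
  qed
  then obtain u where u: "\<And>S. S \<in> B \<Longrightarrow> u S \<in> ?Z UNIV" "\<And>S. S \<in> B \<Longrightarrow> 0 \<le> s S"
    "\<And>S. S \<in> B \<Longrightarrow> s S \<le> (w S * ?k S) *\<^sub>R u S"
    by metis
  have "(\<Sum>S\<in>B. (w S * ?k S) *\<^sub>R u S) \<in> scale_set \<gamma> (?Z UNIV)"
  proof (rule convex_sum_mem_scale_set[OF convex_image_lin zero_mem_image_lin])
    show "(\<Sum>S\<in>B. w S * ?k S) \<le> \<gamma>"
      using balancing_weights_sum_le[OF assms(7) \<open>real CARD('n) \<le> \<gamma>\<close>] .
    show "0 \<le> w S * ?k S" if "S \<in> B" for S
      using wpos(1)[OF that] \<open>0 < \<gamma>\<close> by simp
  qed (use u(1) \<open>0 < \<gamma>\<close> in auto)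
  moreover have "v \<le> (\<Sum>S\<in>B. (w S * ?k S) *\<^sub>R u S)"
    unfolding v using u(3) by (rule sum_mono)
  moreover have "0 \<le> v"
    unfolding v using u(2) by (rule sum_nonneg)
  \<comment> \<open>Domination by a point of the compact scaled image is enough, by the
    characterization of the hull of its Pareto maxima.\<close>
  ultimately show "v \<in> game \<gamma> A b c c0 d d0 UNIV"
    using cptN by (auto simp: game_def comprehensive_hull_pos_pareto_max_iff)
qed

end
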